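(* Let $n$ be a positive integer and let $K_n$ be the complete graph on $n$ vertices. The flow polynomial of $K_n$ satisfies $$F_{K_n}(x)=\frac{(-1)^{\frac{n(n-1)}{2}}}{x^n}\sum_{\lambda}f(\lambda)\,(1-x)^{s(\lambda)}\,x(x-1)\cdots(x-\ell(\lambda)+1),$$ where the sum is over all partitions $\lambda=(\lambda_1,\ldots,\lambda_{\ell(\lambda)})$ of the number $n$, $s(\lambda)=\sum_{i=1}^{\ell(\lambda)}\frac{\lambda_i(\lambda_i-1)}{2}$, and $f(\lambda)$ is the number of ways of dividing a set of $n$ distinct elements into (unordered) parts whose cardinalities are given by $\lambda$.
   Context: A partition $\lambda$ of $n$ is a representation of $n$ as a sum of positive integers $\lambda_1\le\lambda_2\le\dots\le\lambda_m$, the order of summands being irrelevant; $\ell(\lambda)=m$ is its length. If $n_i$ denotes the number of parts of $\lambda$ equal to $i$, then $$f(\lambda)=\frac{n!}{\prod_{i\ge1}(i!)^{n_i}\,n_i!}.$$ The flow polynomial $F_G$ of a graph $G=(V,E)$ is the polynomial such that, for every positive integer $q$, $F_G(q)$ is the number of nowhere-zero flows with values in $\mathbb{Z}_q=\mathbb{Z}/q\mathbb{Z}$: after fixing any orientation of the edges, these are the assignments of a nonzero element $k_e\in\mathbb{Z}_q$ to each edge $e$ such that at every vertex the sum of $k_e$ over incoming edges equals the sum over outgoing edges. Equivalently, $F_G$ is the characteristic polynomial $\chi_{M}(x)=\sum_{A\subseteq E}(-1)^{|A|}x^{r_M(E)-r_M(A)}$ of the dual $M=M_G^*$ of the graphic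 matroid $M_G$ of $G$. *)

theory Defs
  imports
    Complex_Main
    "HOL-Library.Multiset"
    "HOL-Library.FuncSet"
    "HOL-Library.Disjoint_Sets"
    "HOL-Computational_Algebra.Polynomial"
    "HOL-Number_Theory.Cong"
    "Graph_Theory.Digraph"
begin

text \<open>An undirected graph is a pair of its vertex set and its edge set, each edge
  being the set of its end vertices.\<close>

type_synonym 'v graph = "'v set \<times> 'v set set"

definition complete_graph :: "nat \<Rightarrow> nat graph" where
  "complete_graph n = ({..<n}, {e. e \<subseteq> {..<n} \<and> card e = 2})"

text \<open>An orientation of a graph is a digraph whose arcs are the edges themselves,
  each running from one of its end vertices to the other.\<close>

definition orientation :: "'v graph \<Rightarrow> ('v, 'v set) pre_digraph \<Rightarrow> bool" where
  "orientation G D \<longleftrightarrow>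
     verts D = fst G \<and> arcs D = snd G \<and> (\<forall>e\<in>snd G. e = {tail D e, head D e})"

text \<open>The nonzero elements of the integers modulo \<open>q\<close> are represented by \<open>1, \<dots>, q - 1\<close>.
  Flows are extensional functions on the arcs, so that each is counted once.\<close>

definition nowhere_zero_flows :: "('v, 'e) pre_digraph \<Rightarrow> nat \<Rightarrow> ('e \<Rightarrow> nat) set" where
  "nowhere_zero_flows D q =
     {k \<in> arcs D \<rightarrow>\<^sub>E {1..<q}.
        \<forall>v\<in>verts D. [(\<Sum>e\<in>in_arcs D v. k e) = (\<Sum>e\<in>out_arcs D v. k e)] (mod q)}"

text \<open>The number of flows does not depend on the orientation of a finite graph, so all
  orientations are required to give the same values instead of choosing one.\<close>

definition flow_polynomial :: "'v graph \<Rightarrow> complex poly" where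
  "flow_polynomial G =
     (THE p. \<forall>D q. orientation G D \<longrightarrow> q > 0 \<longrightarrow>
        poly p (of_nat q) = of_nat (card (nowhere_zero_flows D q)))"

text \<open>A partition of \<open>n\<close> is the multiset of its parts; its length is the \<open>size\<close> of the multiset.\<close>

definition number_partitions :: "nat \<Rightarrow> nat multiset set" where
  "number_partitions n = {L. sum_mset L = n \<and> 0 \<notin># L}"

text \<open>The number of set partitions of an \<open>n\<close>-element set, \<open>n\<close> being the sum of \<open>L\<close>,
  whose block sizes are the parts of \<open>L\<close>.\<close>

definition num_divisions :: "nat multiset \<Rightarrow> nat" where
  "num_divisions L =
     card {P. partition_on {..<sum_mset L} P \<and> image_mset card (mset_set P) = L}"

definition num_inner_pairs :: "nat multiset \<Rightarrow> nat" where
  "num_inner_pairs L = (\<Sum>i\<in>#L. i * (i - 1) div 2)"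

end

theory Submission
  imports Defs
begin

text \<open>Detecting the conservation laws with the additive characters of the integers modulo \<open>q\<close> gives
  \<open>q ^ n * F(q) = (\<Sum>c. \<Prod>e. q * [c constant on e] - 1)\<close>, where \<open>c\<close> ranges over all maps from the
  vertices to \<open>{..<q}\<close>. The summand depends only on the partition of the vertices into the fibres
  of \<open>c\<close>, and a partition with \<open>m\<close> blocks arises from \<open>q (q - 1) \<dots> (q - m + 1)\<close> maps \<open>c\<close>. Hence the
  claimed formula holds at every positive integer. Its numerator is an integer polynomial whose
  value at \<open>q\<close> is a multiple of \<open>q ^ n\<close> for all \<open>q > 0\<close>, which forces divisibility by \<open>x ^ n\<close>; so the
  formula is a polynomial and therefore is the flow polynomial.\<close>

section \<open>Additive characters of the integers modulo \<open>q\<close>\<close>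

definition residue_char :: "nat \<Rightarrow> int \<Rightarrow> complex" where
  "residue_char q j = cis (2 * pi * of_int j / of_nat q)"

lemma residue_char_0 [simp]: "residue_char q 0 = 1"
  by (simp add: residue_char_def)

lemma residue_char_add: "residue_char q (i + j) = residue_char q i * residue_char q j"
  by (simp add: residue_char_def cis_mult add_divide_distrib distrib_left)

lemma residue_char_sum: "residue_char q (\<Sum>i\<in>I. f i) = (\<Prod>i\<in>I. residue_char q (f i))"
  by (induction I rule: infinite_finite_induct) (simp_all add: residue_char_add)

lemma residue_char_power: "residue_char q (int a * j) = residue_char q j ^ a"
  by (simp add: residue_char_def DeMoivre mult_ac)

lemma residue_char_eq_1_iff:
  assumes "q > 0"
  shows "residue_char q j = 1 \<longleftrightarrow> int q dvd j"
proof
  assume "residue_char q j = 1"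
  then have "cos (2 * pi * of_int j / of_nat q) = 1"
    by (simp add: residue_char_def complex_eq_iff)
  then obtain m :: int where "2 * pi * of_int j / of_nat q = of_int m * 2 * pi"
    by (auto simp: cos_one_2pi_int)
  then have "real_of_int j = of_int (int q * m)"
    using assms by (simp add: field_simps)
  then show "int q dvd j"
    by (metis dvd_triv_left of_int_eq_iff)
next
  assume "int q dvd j"
  then obtain m where "j = int q * m" ..
  then show "residue_char q j = 1"
    using assms cis_multiple_2pi[of "of_int m"] by (simp add: residue_char_def mult.assoc)
qed

text \<open>Orthogonality of characters: the terms are the powers of a \<open>q\<close>-th root of
  unity, so the sum is a geometric one and vanishes unless that root is 1.\<close>

lemma sum_residue_char:
  assumes "q > 0"
  shows "(\<Sum>a<q. residue_char q (int a * j)) = (if int q dvd j then of_nat q else 0)"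
proof (cases "int q dvd j")
  case True
  then show ?thesis
    using assms by (simp add: residue_char_power residue_char_eq_1_iff[THEN iffD2])
next
  case False
  have "residue_char q j ^ q = 1"
    using assms by (simp add: residue_char_eq_1_iff flip: residue_char_power)
  then show ?thesis
    using False assms by (simp add: residue_char_power residue_char_eq_1_iff sum_gp_strict)
qed

text \<open>Discarding the term 1 at \<open>a = 0\<close> leaves the values allowed on an arc of a
  nowhere-zero flow; the result is the weight that an arc will carry.\<close>

lemma sum_residue_char_nonzero:
  assumes "q > 0"
  shows "(\<Sum>a = 1..<q. residue_char q (int a * j)) = (if int q dvd j then of_nat q - 1 else - 1)"
proof -
  have "{..<q} = insert 0 {1..<q}"
    using assms by auto
  then have "(\<Sum>a = 1..<q. residue_char q (int a * j)) = (\<Sum>a<q. residue_char q (int a * j)) - 1"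
    by simp
  then show ?thesis
    unfolding sum_residue_char[OF assms] by simp
qed

section \<open>Counting flows by vertex colourings\<close>

text \<open>Each vertex contributes one factor \<open>q\<close>, because its conservation law is
  detected by an unnormalised sum over \<open>q\<close> characters. Choosing a character at every
  vertex is a colouring \<open>c\<close>; for fixed \<open>c\<close> the sum over all assignments
  \<open>k\<close> factors over the arcs.\<close>

lemma (in fin_digraph) card_nowhere_zero_flows:
  assumes "q > 0"
  shows "of_nat q ^ card (verts G) * of_nat (card (nowhere_zero_flows G q)) =
    (\<Sum>c\<in>verts G \<rightarrow>\<^sub>E {..<q}. \<Prod>e\<in>arcs G.
       if c (tail G e) = c (head G e) then of_nat q - 1 else (- 1 :: complex))"
proof -
  define net where "net k v = (\<Sum>e\<in>in_arcs G v. int (k e)) - (\<Sum>e\<in>out_arcs G v. int (k e))"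
    for k :: "'b \<Rightarrow> nat" and v
  have flow_iff: "[(\<Sum>e\<in>in_arcs G v. k e) = (\<Sum>e\<in>out_arcs G v. k e)] (mod q)
      \<longleftrightarrow> int q dvd net k v" for k v
    by (simp add: net_def cong_iff_dvd_diff flip: cong_int_iff)
  have fin: "finite (arcs G \<rightarrow>\<^sub>E {1..<q})"
    by (simp add: finite_PiE)
  \<comment> \<open>Discrete summation by parts: every arc is counted once with a plus sign at its
    head and once with a minus sign at its tail.\<close>
  have "(\<Sum>v\<in>verts G. int (c v) * net k v) =
      (\<Sum>e\<in>arcs G. int (k e) * (int (c (head G e)) - int (c (tail G e))))" for c k
  proof -
    have "(\<Sum>v\<in>verts G. \<Sum>e\<in>in_arcs G v. int (k e) * int (c v)) =
        (\<Sum>v\<in>verts G. \<Sum>e\<in>{e \<in> arcs G. head G e = v}. int (k e) * int (c (head G e)))"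
      by (intro sum.cong) (auto simp: in_arcs_def)
    also have "\<dots> = (\<Sum>e\<in>arcs G. int (k e) * int (c (head G e)))"
      by (rule sum.group) auto
    finally have "in": "(\<Sum>v\<in>verts G. \<Sum>e\<in>in_arcs G v. int (k e) * int (c v)) = \<dots>" .
    have "(\<Sum>v\<in>verts G. \<Sum>e\<in>out_arcs G v. int (k e) * int (c v)) =
        (\<Sum>v\<in>verts G. \<Sum>e\<in>{e \<in> arcs G. tail G e = v}. int (k e) * int (c (tail G e)))"
      by (intro sum.cong) (auto simp: out_arcs_def)
    also have "\<dots> = (\<Sum>e\<in>arcs G. int (k e) * int (c (tail G e)))"
      by (rule sum.group) auto
    finally have out: "(\<Sum>v\<in>verts G. \<Sum>e\<in>out_arcs G v. int (k e) * int (c v)) = \<dots>" .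
    from "in" out show ?thesis
      by (simp add: net_def right_diff_distrib sum_subtractf sum_distrib_left mult.commute)
  qed
  then have char: "(\<Prod>v\<in>verts G. residue_char q (int (c v) * net k v)) =
      (\<Prod>e\<in>arcs G. residue_char q (int (k e) * (int (c (head G e)) - int (c (tail G e)))))" for c k
    by (simp flip: residue_char_sum)
  have "of_nat q ^ card (verts G) * of_nat (card (nowhere_zero_flows G q)) =
      (\<Sum>k\<in>nowhere_zero_flows G q. of_nat q ^ card (verts G) :: complex)"
    by simp
  also have "\<dots> = (\<Sum>k\<in>arcs G \<rightarrow>\<^sub>E {1..<q}.
      if \<forall>v\<in>verts G. int q dvd net k v then of_nat q ^ card (verts G) else 0)"
    unfolding nowhere_zero_flows_def flow_iff using fin by (rule sum.inter_filter)
  also have "\<dots> = (\<Sum>k\<in>arcs G \<rightarrow>\<^sub>E {1..<q}. \<Prod>v\<in>verts G. \<Sum>a<q. residue_char q (int a * net k v))"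
  proof (rule sum.cong)
    fix k
    have "(\<Prod>v\<in>verts G. if int q dvd net k v then of_nat q else 0) = (0 :: complex)"
      if "v \<in> verts G" "\<not> int q dvd net k v" for v
      using that by (intro prod_zero) auto
    then show "(if \<forall>v\<in>verts G. int q dvd net k v then of_nat q ^ card (verts G) else 0) =
        (\<Prod>v\<in>verts G. \<Sum>a<q. residue_char q (int a * net k v))"
      by (auto simp: sum_residue_char[OF assms])
  qed simp
  \<comment> \<open>Expanding the product over vertices picks one \<open>a\<close> per vertex, that
    is, a map \<open>c\<close>.\<close>
  also have "\<dots> = (\<Sum>k\<in>arcs G \<rightarrow>\<^sub>E {1..<q}. \<Sum>c\<in>verts G \<rightarrow>\<^sub>E {..<q}.
      \<Prod>v\<in>verts G. residue_char q (int (c v) * net k v))"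
    by (simp add: prod_sum_PiE)
  also have "\<dots> = (\<Sum>c\<in>verts G \<rightarrow>\<^sub>E {..<q}. \<Sum>k\<in>arcs G \<rightarrow>\<^sub>E {1..<q}.
      \<Prod>e\<in>arcs G. residue_char q (int (k e) * (int (c (head G e)) - int (c (tail G e)))))"
    unfolding char by (rule sum.swap)
  also have "\<dots> = (\<Sum>c\<in>verts G \<rightarrow>\<^sub>E {..<q}. \<Prod>e\<in>arcs G.
      \<Sum>a = 1..<q. residue_char q (int a * (int (c (head G e)) - int (c (tail G e)))))"
    by (simp add: prod_sum_PiE)
  also have "\<dots> = (\<Sum>c\<in>verts G \<rightarrow>\<^sub>E {..<q}. \<Prod>e\<in>arcs G.
      if c (tail G e) = c (head G e) then of_nat q - 1 else - 1)"
  proof (intro sum.cong prod.cong refl)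
    fix c e
    assume "c \<in> verts G \<rightarrow>\<^sub>E {..<q}" "e \<in> arcs G"
    then have "c (head G e) < q" "c (tail G e) < q"
      by (auto simp: PiE_iff)
    \<comment> \<open>Both colours are least residues, so congruence modulo \<open>q\<close> is
      equality.\<close>
    then have "[c (head G e) = c (tail G e)] (mod q) \<longleftrightarrow> c (tail G e) = c (head G e)"
      by (auto dest: cong_less_modulus_unique_nat)
    then have "int q dvd int (c (head G e)) - int (c (tail G e)) \<longleftrightarrow> c (tail G e) = c (head G e)"
      by (simp add: cong_int_iff flip: cong_iff_dvd_diff)
    then show "(\<Sum>a = 1..<q. residue_char q (int a * (int (c (head G e)) - int (c (tail G e))))) =
        (if c (tail G e) = c (head G e) then of_nat q - 1 else - 1)"
      unfolding sum_residue_char_nonzero[OF assms] by simp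
  qed
  finally show ?thesis .
qed

section \<open>Maps with a prescribed partition into fibres\<close>

lemma card_injections:
  fixes A :: "'b set" and B :: "'c set"
  assumes "finite A" "finite B"
  shows "(of_nat (card {g \<in> A \<rightarrow>\<^sub>E B. inj_on g A}) :: 'a::comm_ring_1) =
    (\<Prod>i<card A. of_nat (card B) - of_nat i)"
  using assms(1)
proof (induction A rule: finite_induct)
  case empty
  then show ?case by simp
next
  case (insert x A)
  define I where "I A = {g \<in> A \<rightarrow>\<^sub>E B. inj_on g A}" for A :: "'b set"
  have "finite (A \<rightarrow>\<^sub>E B)"
    by (simp add: finite_PiE insert.hyps(1) assms(2))
  then have fin: "finite (I A)"
    unfolding I_def by (rule rev_finite_subset) (rule Collect_restrict)
  have "bij_betw (\<lambda>(g, y). g(x := y)) (Sigma (I A) (\<lambda>g. B - g ` A)) (I (insert x A))"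
  proof (rule bij_betwI[where g = "\<lambda>g. (restrict g A, g x)"])
    show "(\<lambda>(g, y). g(x := y)) \<in> Sigma (I A) (\<lambda>g. B - g ` A) \<rightarrow> I (insert x A)"
    proof clarify
      fix g y assume "g \<in> I A" and y: "y \<in> B" "y \<notin> g ` A"
      then have g: "g \<in> A \<rightarrow>\<^sub>E B" "inj_on g A"
        unfolding I_def by blast+
      from g(2) y(2) have "inj_on (g(x := y)) A"
        by (rule inj_on_fun_updI)
      moreover have "(g(x := y)) ` A = g ` A"
        using insert.hyps(2) by (intro image_cong) auto
      ultimately show "g(x := y) \<in> I (insert x A)"
        unfolding I_def using PiE_fun_upd[OF y(1) g(1)] y(2) insert.hyps(2) by simp
    qed
    show "(\<lambda>g. (restrict g A, g x)) \<in> I (insert x A) \<rightarrow> Sigma (I A) (\<lambda>g. B - g ` A)"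
    proof
      fix g assume "g \<in> I (insert x A)"
      then have g: "g \<in> insert x A \<rightarrow>\<^sub>E B" "inj_on g (insert x A)"
        unfolding I_def by blast+
      have "inj_on g A" "g x \<notin> g ` A"
        using g(2) insert.hyps(2) by simp_all
      moreover have "restrict g A \<in> A \<rightarrow>\<^sub>E B" "g x \<in> B"
        using PiE_mem[OF g(1)] by simp_all
      ultimately show "(restrict g A, g x) \<in> Sigma (I A) (\<lambda>g. B - g ` A)"
        unfolding I_def by (simp add: inj_on_restrict_eq)
    qed
    show "(\<lambda>g. (restrict g A, g x)) ((\<lambda>(g, y). g(x := y)) p) = p"
      if "p \<in> Sigma (I A) (\<lambda>g. B - g ` A)" for p
    proof -
      obtain g y where p: "p = (g, y)"
        by (rule prod.exhaust)
      then have "g \<in> A \<rightarrow>\<^sub>E B"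
        using that by (simp add: I_def)
      then have "restrict g A = g"
        by (rule PiE_restrict)
      then show ?thesis
        using insert.hyps(2) by (simp add: p restrict_upd)
    qed
    show "(\<lambda>(g, y). g(x := y)) (restrict g A, g x) = g" if "g \<in> I (insert x A)" for g
    proof -
      have g: "g \<in> insert x A \<rightarrow>\<^sub>E B"
        using that unfolding I_def by blast
      have "((restrict g A)(x := g x)) v = g v" for v
        using PiE_arb[OF g, of v] by simp
      then show ?thesis
        by (simp add: fun_eq_iff)
    qed
  qed
  then have "card (I (insert x A)) = card (Sigma (I A) (\<lambda>g. B - g ` A))"
    by (rule bij_betw_same_card[symmetric])
  also have "\<dots> = (\<Sum>g\<in>I A. card (B - g ` A))"
    using fin assms(2) by (simp add: card_SigmaI)
  finally have "of_nat (card (I (insert x A))) = (\<Sum>g\<in>I A. of_nat (card (B - g ` A)) :: 'a)"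
    by simp
  also have "\<dots> = (\<Sum>g\<in>I A. of_nat (card B) - of_nat (card A))"
  proof (rule sum.cong)
    fix g assume g: "g \<in> I A"
    then have "g ` A \<subseteq> B" and "card (g ` A) = card A"
      unfolding I_def by (blast, simp add: card_image)
    \<comment> \<open>An injection \<open>g\<close> exists here, so \<open>card A\<close> is at most
      \<open>card B\<close> and the subtraction of natural numbers is not truncated.\<close>
    moreover have "card (g ` A) \<le> card B"
      using assms(2) \<open>g ` A \<subseteq> B\<close> by (rule card_mono)
    ultimately show "of_nat (card (B - g ` A)) = (of_nat (card B) - of_nat (card A) :: 'a)"
      using insert.hyps by (simp add: card_Diff_subset)
  qed simp
  finally show ?case
    using insert by (simp add: I_def mult.commute)
qed

text \<open>Only fibres over the image are taken, which keeps the empty set out of the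
  partition.\<close>

definition kernel_partition :: "('a \<Rightarrow> 'b) \<Rightarrow> 'a set \<Rightarrow> 'a set set" where
  "kernel_partition c V = (\<lambda>y. c -` {y} \<inter> V) ` c ` V"

lemma partition_on_kernel_partition: "partition_on V (kernel_partition c V)"
  by (rule partition_onI) (auto simp: kernel_partition_def disjnt_def)

text \<open>By the second assumption the fibre through any point of a block is that block. Blocks
  cover \<open>V\<close>, so every fibre is a block; blocks are nonempty, so every block is a
  fibre.\<close>

lemma kernel_partition_eqI:
  assumes P: "partition_on V P"
    and eq: "\<And>B v w. B \<in> P \<Longrightarrow> v \<in> B \<Longrightarrow> w \<in> V \<Longrightarrow> c w = c v \<longleftrightarrow> w \<in> B"
  shows "kernel_partition c V = P"
proof -
  have fibre: "c -` {c v} \<inter> V = B" if "B \<in> P" "v \<in> B" for B v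
  proof (rule set_eqI)
    fix w
    show "w \<in> c -` {c v} \<inter> V \<longleftrightarrow> w \<in> B"
      using eq[OF that, of w] that partition_onD1[OF P] by (cases "w \<in> V") auto
  qed
  show ?thesis
  proof (intro equalityI subsetI)
    fix X assume "X \<in> kernel_partition c V"
    then obtain v where "v \<in> V" "X = c -` {c v} \<inter> V"
      by (auto simp: kernel_partition_def)
    then show "X \<in> P"
      using fibre partition_onD1[OF P] by auto
  next
    fix B assume "B \<in> P"
    moreover obtain v where "v \<in> B"
      using partition_onD3[OF P] \<open>B \<in> P\<close> by (metis ex_in_conv)
    ultimately show "B \<in> kernel_partition c V"
      using fibre[of B v] partition_onD1[OF P] unfolding kernel_partition_def by blast
  qed
qed

text \<open>A map whose fibres are the blocks of \<open>P\<close> amounts to an injective labelling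
  of the blocks by elements of \<open>B\<close>.\<close>

lemma card_kernel_partition_eq:
  assumes "finite V" "finite B" and P: "partition_on V P"
  shows "(of_nat (card {c \<in> V \<rightarrow>\<^sub>E B. kernel_partition c V = P}) :: 'a::comm_ring_1) =
    (\<Prod>i<card P. of_nat (card B) - of_nat i)"
proof -
  define block where "block v = (THE X. X \<in> P \<and> v \<in> X)" for v
  have block: "block v = X" if "X \<in> P" "v \<in> X" for v X
    unfolding block_def using that partition_onD2[OF P]
    by (intro the_equality) (auto simp: disjoint_def)
  have block_in: "block v \<in> P" "v \<in> block v" if v: "v \<in> V" for v
  proof -
    obtain X where "X \<in> P" "v \<in> X"
      using v partition_onD1[OF P] by blast
    then show "block v \<in> P" "v \<in> block v"
      by (simp_all only: block)
  qed
  define rep where "rep X = (SOME v. v \<in> X)" for X :: "'b set"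
  have rep: "rep X \<in> X" "rep X \<in> V" if "X \<in> P" for X
  proof -
    have "X \<noteq> {}"
      using that partition_onD3[OF P] by blast
    then show "rep X \<in> X"
      unfolding rep_def by (rule some_in_eq[THEN iffD2])
    then show "rep X \<in> V"
      using that partition_onD1[OF P] by blast
  qed
  \<comment> \<open>Converse of \<open>kernel_partition_eqI\<close>: with kernel \<open>P\<close>,
    equal values mean lying in the same block.\<close>
  have const: "c v = c w \<longleftrightarrow> w \<in> X"
    if X: "kernel_partition c V = P" "X \<in> P" and vw: "v \<in> X" "w \<in> V" for c :: "'b \<Rightarrow> 'c" and v w X
  proof -
    obtain y where "X = c -` {y} \<inter> V"
      using X unfolding kernel_partition_def by blast
    then show ?thesis
      using vw by auto
  qed
  \<comment> \<open>A map is read off at one representative per block; the inverse gives each point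
    the label of its block.\<close>
  have "bij_betw (\<lambda>c. \<lambda>X\<in>P. c (rep X)) {c \<in> V \<rightarrow>\<^sub>E B. kernel_partition c V = P}
      {g \<in> P \<rightarrow>\<^sub>E B. inj_on g P}"
  proof (rule bij_betwI[where g = "\<lambda>g. \<lambda>v\<in>V. g (block v)"])
    show "(\<lambda>c. \<lambda>X\<in>P. c (rep X)) \<in>
        {c \<in> V \<rightarrow>\<^sub>E B. kernel_partition c V = P} \<rightarrow> {g \<in> P \<rightarrow>\<^sub>E B. inj_on g P}"
    proof
      fix c assume "c \<in> {c \<in> V \<rightarrow>\<^sub>E B. kernel_partition c V = P}"
      then have c: "c \<in> V \<rightarrow>\<^sub>E B" "kernel_partition c V = P"
        by blast+
      have "inj_on (\<lambda>X. c (rep X)) P"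
      proof (rule inj_onI)
        fix X Y assume XY: "X \<in> P" "Y \<in> P" "c (rep X) = c (rep Y)"
        then have "rep Y \<in> X"
          using const[OF c(2)] rep by blast
        then have "block (rep Y) = X" "block (rep Y) = Y"
          using block rep XY by blast+
        then show "X = Y"
          by simp
      qed
      then show "(\<lambda>X\<in>P. c (rep X)) \<in> {g \<in> P \<rightarrow>\<^sub>E B. inj_on g P}"
        using PiE_mem[OF c(1)] rep by (simp add: inj_on_restrict_eq)
    qed
  next
    show "(\<lambda>g. \<lambda>v\<in>V. g (block v)) \<in>
        {g \<in> P \<rightarrow>\<^sub>E B. inj_on g P} \<rightarrow> {c \<in> V \<rightarrow>\<^sub>E B. kernel_partition c V = P}"
    proof
      fix g assume "g \<in> {g \<in> P \<rightarrow>\<^sub>E B. inj_on g P}"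
      then have g: "g \<in> P \<rightarrow>\<^sub>E B" "inj_on g P"
        by blast+
      have "kernel_partition (\<lambda>v\<in>V. g (block v)) V = P"
      proof (rule kernel_partition_eqI[OF P])
        fix X v w assume Xvw: "X \<in> P" "v \<in> X" "w \<in> V"
        then have v: "block v = X" "v \<in> V"
          using block partition_onD1[OF P] by blast+
        have "g (block w) = g X \<longleftrightarrow> block w = X"
          using g(2) block_in(1)[OF Xvw(3)] Xvw(1) by (rule inj_on_eq_iff)
        also have "\<dots> \<longleftrightarrow> w \<in> X"
          using Xvw block block_in by blast
        finally show "(\<lambda>v\<in>V. g (block v)) w = (\<lambda>v\<in>V. g (block v)) v \<longleftrightarrow> w \<in> X"
          using v Xvw(3) by simp
      qed
      then show "(\<lambda>v\<in>V. g (block v)) \<in> {c \<in> V \<rightarrow>\<^sub>E B. kernel_partition c V = P}"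
        using PiE_mem[OF g(1)] block_in(1) by simp
    qed
  next
    fix c assume "c \<in> {c \<in> V \<rightarrow>\<^sub>E B. kernel_partition c V = P}"
    then have c: "c \<in> V \<rightarrow>\<^sub>E B" "kernel_partition c V = P"
      by blast+
    show "(\<lambda>v\<in>V. (\<lambda>X\<in>P. c (rep X)) (block v)) = c"
    proof (rule ext)
      fix v
      show "(\<lambda>v\<in>V. (\<lambda>X\<in>P. c (rep X)) (block v)) v = c v"
      proof (cases "v \<in> V")
        case True
        then have "c (rep (block v)) = c v"
          using const[OF c(2) block_in(1) rep(1)[OF block_in(1)]] block_in(2) by blast
        then show ?thesis
          using True block_in(1) by simp
      next
        case False
        then show ?thesis
          using PiE_arb[OF c(1)] by simp
      qed
    qed
  next
    fix g assume "g \<in> {g \<in> P \<rightarrow>\<^sub>E B. inj_on g P}"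
    then have g: "g \<in> P \<rightarrow>\<^sub>E B"
      by blast
    show "(\<lambda>X\<in>P. (\<lambda>v\<in>V. g (block v)) (rep X)) = g"
    proof (rule ext)
      fix X
      show "(\<lambda>X\<in>P. (\<lambda>v\<in>V. g (block v)) (rep X)) X = g X"
        using PiE_arb[OF g] rep[of X] block[of X "rep X"] by simp
    qed
  qed
  from bij_betw_same_card[OF this] show ?thesis
    using card_injections[OF finite_elements[OF assms(1) P] assms(2)] by simp
qed

section \<open>Flow counts of complete graphs\<close>

text \<open>Distinct blocks are disjoint, so no pair lies in two of them and the counts add. For the
  kernel of a colouring these pairs are the edges with equally coloured ends.\<close>

lemma card_pairs_in_blocks:
  assumes "finite V" and P: "partition_on V P"
  shows "card {e. card e = 2 \<and> (\<exists>B\<in>P. e \<subseteq> B)} = (\<Sum>B\<in>P. card B choose 2)"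
proof -
  have "{e. card e = 2 \<and> (\<exists>B\<in>P. e \<subseteq> B)} = (\<Union>B\<in>P. {e. e \<subseteq> B \<and> card e = 2})"
    by auto
  also have "card \<dots> = (\<Sum>B\<in>P. card {e. e \<subseteq> B \<and> card e = 2})"
  proof (rule card_UN_disjoint)
    show "finite P"
      using assms by (rule finite_elements)
    show "\<forall>B\<in>P. finite {e. e \<subseteq> B \<and> card e = 2}"
      using assms(1) partition_onD1[OF P] by (auto intro!: finite_subset[of _ "Pow V"])
    show "\<forall>B\<in>P. \<forall>C\<in>P. B \<noteq> C \<longrightarrow> {e. e \<subseteq> B \<and> card e = 2} \<inter> {e. e \<subseteq> C \<and> card e = 2} = {}"
    proof (intro ballI impI)
      fix B C assume "B \<in> P" "C \<in> P" "B \<noteq> C"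
      then have "B \<inter> C = {}"
        using partition_onD2[OF P] by (auto simp: disjoint_def)
      then have "card e \<noteq> 2" if "e \<subseteq> B" "e \<subseteq> C" for e
        using subset_empty[of e] Int_greatest[OF that] by auto
      then show "{e. e \<subseteq> B \<and> card e = 2} \<inter> {e. e \<subseteq> C \<and> card e = 2} = {}"
        by blast
    qed
  qed
  also have "\<dots> = (\<Sum>B\<in>P. card B choose 2)"
    using assms(1) partition_onD1[OF P]
    by (intro sum.cong refl n_subsets) (auto intro: finite_subset)
  finally show ?thesis .
qed

text \<open>Taking -1 out of every arc weight gives the global sign and leaves \<open>1 - q\<close>
  on edges inside a fibre and 1 on all others. The weight of a colouring then depends only on its
  kernel, and colourings are grouped accordingly.\<close>

lemma nowhere_zero_flows_complete_graph:
  assumes D: "orientation (complete_graph n) D" and "q > 0"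
  shows "(of_nat q ^ n * of_nat (card (nowhere_zero_flows D q)) :: complex) =
    (- 1) ^ (n choose 2) * (\<Sum>P | partition_on {..<n} P.
      (1 - of_nat q) ^ (\<Sum>B\<in>P. card B choose 2) * (\<Prod>i<card P. of_nat q - of_nat i))"
proof -
  have V: "verts D = {..<n}" and E: "arcs D = {e. e \<subseteq> {..<n} \<and> card e = 2}"
    using D by (auto simp: orientation_def complete_graph_def)
  have ends: "e = {tail D e, head D e}" if "e \<in> arcs D" for e
    using D that unfolding orientation_def by auto
  interpret fin_digraph D
  proof
    fix e assume "e \<in> arcs D"
    then show "tail D e \<in> verts D" "head D e \<in> verts D"
      using ends[of e] V E by auto
  qed (simp_all add: V E)
  have weight: "(\<Prod>e\<in>arcs D. if c (tail D e) = c (head D e) then of_nat q - 1 else - 1 :: complex) =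
      (- 1) ^ (n choose 2) * (1 - of_nat q) ^ (\<Sum>B\<in>kernel_partition c {..<n}. card B choose 2)"
    for c :: "nat \<Rightarrow> nat"
  proof -
    \<comment> \<open>An edge has equally coloured ends exactly when it lies inside one
      fibre.\<close>
    have "{e \<in> arcs D. c (tail D e) = c (head D e)} =
        {e. card e = 2 \<and> (\<exists>B\<in>kernel_partition c {..<n}. e \<subseteq> B)}"
    proof (intro equalityI subsetI)
      fix e assume "e \<in> {e \<in> arcs D. c (tail D e) = c (head D e)}"
      then have e: "e \<in> arcs D" "c (tail D e) = c (head D e)"
        by auto
      have "v = tail D e \<or> v = head D e" if "v \<in> e" for v
        using ends[OF e(1)] that by blast
      then have "e \<subseteq> c -` {c (tail D e)} \<inter> {..<n}"
        using e E by auto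
      then show "e \<in> {e. card e = 2 \<and> (\<exists>B\<in>kernel_partition c {..<n}. e \<subseteq> B)}"
        using e(1) E tail_in_verts[OF e(1)] V by (auto simp: kernel_partition_def)
    next
      fix e assume "e \<in> {e. card e = 2 \<and> (\<exists>B\<in>kernel_partition c {..<n}. e \<subseteq> B)}"
      then obtain y where y: "card e = 2" "e \<subseteq> c -` {y} \<inter> {..<n}"
        by (auto simp: kernel_partition_def)
      then have "e \<in> arcs D"
        by (auto simp: E)
      with y(2) ends[OF this] show "e \<in> {e \<in> arcs D. c (tail D e) = c (head D e)}"
        by auto
    qed
    then have "card {e \<in> arcs D. c (tail D e) = c (head D e)} =
        (\<Sum>B\<in>kernel_partition c {..<n}. card B choose 2)"
      by (simp add: card_pairs_in_blocks[OF _ partition_on_kernel_partition])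
    moreover have "(\<Prod>e\<in>arcs D. if c (tail D e) = c (head D e) then of_nat q - 1 else - 1 :: complex) =
        (\<Prod>e\<in>arcs D. - 1 * (if c (tail D e) = c (head D e) then 1 - of_nat q else 1))"
      by (intro prod.cong) auto
    moreover have "\<dots> = (- 1) ^ card (arcs D) *
        (1 - of_nat q) ^ card {e \<in> arcs D. c (tail D e) = c (head D e)}"
      unfolding prod.distrib by (simp flip: prod.inter_filter)
    moreover have "card (arcs D) = n choose 2"
      using n_subsets[of "{..<n}" 2] by (simp add: E)
    ultimately show ?thesis
      by simp
  qed
  let ?C = "{..<n} \<rightarrow>\<^sub>E {..<q}" and ?w = "\<lambda>P. (1 - of_nat q :: complex) ^ (\<Sum>B\<in>P. card B choose 2)"
  have "(\<Sum>c\<in>?C. ?w (kernel_partition c {..<n})) =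
      (\<Sum>P | partition_on {..<n} P. \<Sum>c | c \<in> ?C \<and> kernel_partition c {..<n} = P.
        ?w (kernel_partition c {..<n}))"
    by (rule sum.group[symmetric])
      (auto intro: finite_PiE finitely_many_partition_on partition_on_kernel_partition)
  also have "\<dots> = (\<Sum>P | partition_on {..<n} P. ?w P * (\<Prod>i<card P. of_nat q - of_nat i))"
    by (intro sum.cong) (auto simp: mult.commute card_kernel_partition_eq)
  finally show ?thesis
    using card_nowhere_zero_flows[OF \<open>q > 0\<close>] by (simp add: V weight flip: sum_distrib_left)
qed

section \<open>From set partitions to number partitions\<close>

text \<open>Since all parts are positive, both the length and every part are at most
  \<open>n\<close>, leaving finitely many multisets.\<close>

lemma finite_number_partitions: "finite (number_partitions n)"
proof (rule finite_subset)
  have "size L \<le> sum_mset L \<and> set_mset L \<subseteq> {..sum_mset L}" if "0 \<notin># L" for L :: "nat multiset"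
    using that by (induction L) fastforce+
  then show "number_partitions n \<subseteq> (\<Union>k\<le>n. multisets_of_size {..n} k)"
    by (auto simp: number_partitions_def multisets_of_size_def)
qed auto

text \<open>Set partitions are grouped by their multiset of block sizes; the group belonging to
  \<open>L\<close> has \<open>num_divisions L\<close> members by definition.\<close>

lemma sum_set_partitions_by_type:
  fixes h :: "nat multiset \<Rightarrow> 'a::semiring_1"
  shows "(\<Sum>P | partition_on {..<n} P. h (image_mset card (mset_set P))) =
    (\<Sum>L\<in>number_partitions n. of_nat (num_divisions L) * h L)"
proof -
  let ?type = "\<lambda>P :: nat set set. image_mset card (mset_set P)"
  \<comment> \<open>Block sizes add up to \<open>n\<close> by disjointness, and none is 0 because
    blocks are nonempty.\<close>
  have "?type P \<in> number_partitions n" if P: "partition_on {..<n} P" for P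
  proof -
    have fin: "finite P" "\<And>B. B \<in> P \<Longrightarrow> finite B"
      using finite_elements[OF _ P] partition_onD1[OF P] by (auto intro: finite_subset)
    have "(\<Sum>B\<in>P. card B) = card (\<Union>P)"
      using partition_onD2[OF P] fin by (simp add: card_Union_disjoint disjoint_def pairwise_def disjnt_def)
    moreover have "\<Union>P = {..<n}"
      using partition_onD1[OF P] by simp
    ultimately show ?thesis
      using fin partition_onD3[OF P]
      by (auto simp: number_partitions_def sum_unfold_sum_mset)
  qed
  then have "(\<Sum>P | partition_on {..<n} P. h (?type P)) =
      (\<Sum>L\<in>number_partitions n. \<Sum>P | P \<in> {P. partition_on {..<n} P} \<and> ?type P = L. h (?type P))"
    by (intro sum.group[symmetric] finite_number_partitions finitely_many_partition_on) auto
  also have "\<dots> = (\<Sum>L\<in>number_partitions n. of_nat (num_divisions L) * h L)"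
    by (intro sum.cong) (auto simp: num_divisions_def number_partitions_def)
  finally show ?thesis .
qed

section \<open>Polynomials and their values at positive integers\<close>

text \<open>One power of the variable is split off at a time: once \<open>p\<close> is
  \<open>monom 1 n * r\<close>, cancelling \<open>q ^ n\<close> shows that every positive
  \<open>q\<close> divides the value of \<open>r\<close> at \<open>q\<close>, hence its constant
  term, which must then be 0.\<close>

lemma monom_dvd_if_power_dvd_values:
  fixes p :: "int poly"
  assumes "\<And>q. q > 0 \<Longrightarrow> int q ^ n dvd poly p (int q)"
  shows "monom 1 n dvd p"
  using assms
proof (induction n)
  case 0
  then show ?case by simp
next
  case (Suc n)
  have "int q ^ n dvd poly p (int q)" if "q > 0" for q
    using Suc.prems[OF that] by (rule power_le_dvd) simp
  then obtain r where r: "p = monom 1 n * r"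
    using Suc.IH by (auto elim: dvdE)
  obtain a s where s: "r = pCons a s"
    by (cases r)
  have "int q dvd a" if "q > 0" for q
  proof -
    have "int q ^ n * int q dvd int q ^ n * poly r (int q)"
      using Suc.prems[OF that] by (simp add: r poly_monom mult.commute)
    then have "int q dvd a + int q * poly s (int q)"
      using that by (simp add: s)
    then show ?thesis
      by (simp add: dvd_add_left_iff)
  qed
  \<comment> \<open>A modulus larger than the absolute value of \<open>a\<close> can divide
    \<open>a\<close> only if \<open>a\<close> is 0.\<close>
  from this[of "nat \<bar>a\<bar> + 1"] have "\<bar>a\<bar> + 1 dvd a"
    by (simp add: add.commute)
  then have "a = 0"
    using dvd_imp_le_int[of a "\<bar>a\<bar> + 1"] by linarith
  then have "p = monom 1 (Suc n) * s"
    by (simp add: r s monom_Suc)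
  then show ?case
    by simp
qed

text \<open>In characteristic 0 the positive integers are infinitely many roots of the
  difference.\<close>

lemma poly_eqI_of_nat:
  fixes p r :: "'a::{idom, ring_char_0} poly"
  assumes "\<And>q. q > 0 \<Longrightarrow> poly p (of_nat q) = poly r (of_nat q)"
  shows "p = r"
proof (rule ccontr)
  assume "p \<noteq> r"
  then have "finite {x. poly (p - r) x = 0}"
    by (intro poly_roots_finite) simp
  moreover have "range (\<lambda>q. of_nat (Suc q)) \<subseteq> {x. poly (p - r) x = 0}"
    using assms[of "Suc _"] by (auto simp del: of_nat_Suc)
  ultimately have "finite (range (\<lambda>q. of_nat (Suc q) :: 'a))"
    by (rule rev_finite_subset)
  moreover have "inj (\<lambda>q. of_nat (Suc q) :: 'a)"
    by (rule injI) (simp del: of_nat_Suc)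
  ultimately show False
    using range_inj_infinite by blast
qed

lemma poly_map_poly_of_int:
  "poly (map_poly of_int p) (of_int x :: 'a::comm_ring_1) = of_int (poly p x)"
  by (induction p) (auto simp: map_poly_pCons)

section \<open>The numerator and the flow polynomial\<close>

text \<open>The coefficient ring is left open: divisibility by a power of the variable is proved
  over \<open>int\<close>, while the flow polynomial lives over \<open>complex\<close>.\<close>

definition flow_numerator :: "nat \<Rightarrow> 'a::comm_ring_1 poly" where
  "flow_numerator n = (- 1) ^ (n choose 2) * (\<Sum>L\<in>number_partitions n.
     of_nat (num_divisions L) * (1 - [:0, 1:]) ^ num_inner_pairs L *
     (\<Prod>i<size L. [:0, 1:] - of_nat i))"

lemma poly_flow_numerator:
  "poly (flow_numerator n) x = (- 1) ^ (n choose 2) * (\<Sum>L\<in>number_partitions n.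
     of_nat (num_divisions L) * (1 - x) ^ num_inner_pairs L * (\<Prod>i<size L. x - of_nat i))"
  by (simp add: flow_numerator_def poly_sum poly_prod)

text \<open>Both exponent and number of blocks depend only on the type of a set partition, so the
  sum over set partitions can be sorted by type.\<close>

lemma poly_flow_numerator_of_nat:
  assumes "orientation (complete_graph n) D" "q > 0"
  shows "poly (flow_numerator n) (of_nat q :: complex) =
    of_nat q ^ n * of_nat (card (nowhere_zero_flows D q))"
proof -
  let ?h = "\<lambda>L. (1 - of_nat q :: complex) ^ num_inner_pairs L * (\<Prod>i<size L. of_nat q - of_nat i)"
  have "(\<Sum>L\<in>number_partitions n. of_nat (num_divisions L) * ?h L) =
      (\<Sum>P | partition_on {..<n} P. ?h (image_mset card (mset_set P)))"
    by (rule sum_set_partitions_by_type[symmetric])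
  then show ?thesis
    unfolding nowhere_zero_flows_complete_graph[OF assms]
    by (simp add: poly_flow_numerator num_inner_pairs_def choose_two sum_unfold_sum_mset
        image_mset.compositionality comp_def mult.assoc)
qed

text \<open>Some orientation must exist, since otherwise the condition defining
  \<open>flow_polynomial\<close> would be vacuous and single out no polynomial. Here each edge runs
  from its smaller to its larger end.\<close>

lemma orientation_Min_Max:
  "orientation (complete_graph n)
    \<lparr>verts = {..<n}, arcs = {e. e \<subseteq> {..<n} \<and> card e = 2}, tail = Min, head = Max\<rparr>"
proof -
  have "{i, j} = {Min {i, j}, Max {i, j}}" for i j :: nat
    by (cases "i \<le> j") auto
  then have "e = {Min e, Max e}" if "card e = 2" for e :: "nat set"
    using that unfolding card_2_iff by metis
  then show ?thesis
    by (simp add: orientation_def complete_graph_def)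
qed

text \<open>The quotient of the numerator by the power of the variable exists over
  \<open>int\<close> and, carried over to \<open>complex\<close>, meets the defining condition of
  the flow polynomial.\<close>

lemma monom_mult_flow_polynomial:
  "monom 1 n * flow_polynomial (complete_graph n) = flow_numerator n"
proof -
  define D where "D = \<lparr>verts = {..<n}, arcs = {e. e \<subseteq> {..<n} \<and> card e = 2}, tail = Min, head = Max\<rparr>"
  have D: "orientation (complete_graph n) D"
    unfolding D_def by (rule orientation_Min_Max)
  have of_int_numerator: "of_int (poly (flow_numerator n) x) = poly (flow_numerator n) (of_int x :: complex)" for x
    by (simp add: poly_flow_numerator)
  have value_eq: "poly (flow_numerator n) (int q) = int q ^ n * int (card (nowhere_zero_flows D q))"
    if "q > 0" for q
  proof -
    have "(of_int (poly (flow_numerator n) (int q)) :: complex) =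
        of_int (int q ^ n * int (card (nowhere_zero_flows D q)))"
      using poly_flow_numerator_of_nat[OF D that] by (simp add: of_int_numerator)
    then show ?thesis
      by (simp only: of_int_eq_iff)
  qed
  then have "monom 1 n dvd (flow_numerator n :: int poly)"
    by (intro monom_dvd_if_power_dvd_values) simp
  then obtain r :: "int poly" where r: "flow_numerator n = monom 1 n * r"
    by (elim dvdE)
  let ?F = "map_poly of_int r :: complex poly"
  have F: "monom 1 n * ?F = flow_numerator n"
  proof (rule poly_eqI_of_nat)
    fix q :: nat
    show "poly (monom 1 n * ?F) (of_nat q) = poly (flow_numerator n) (of_nat q)"
      using of_int_numerator[of "int q"] poly_map_poly_of_int[of r "int q", where ?'a = complex]
      by (simp add: r poly_monom)
  qed
  \<comment> \<open>For existence, the nonzero factor \<open>q ^ n\<close> is cancelled, for an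
    arbitrary orientation. For uniqueness, the one orientation \<open>D\<close> already fixes the
    values at all positive integers.\<close>
  have "flow_polynomial (complete_graph n) = ?F"
    unfolding flow_polynomial_def
  proof (rule the_equality)
    show "\<forall>D q. orientation (complete_graph n) D \<longrightarrow> q > 0 \<longrightarrow>
        poly ?F (of_nat q) = of_nat (card (nowhere_zero_flows D q))"
    proof (intro allI impI)
      fix D q assume "orientation (complete_graph n) D" and q: "q > (0::nat)"
      from poly_flow_numerator_of_nat[OF this]
      show "poly ?F (of_nat q) = of_nat (card (nowhere_zero_flows D q))"
        using q by (simp add: poly_monom flip: F)
    qed
    then show "p = ?F" if "\<forall>D q. orientation (complete_graph n) D \<longrightarrow> q > 0 \<longrightarrow>
        poly p (of_nat q) = of_nat (card (nowhere_zero_flows D q))" for p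
      using that D by (intro poly_eqI_of_nat) auto
  qed
  with F show ?thesis
    by (simp only:)
qed

theorem theorem3:
  fixes n :: nat and x :: complex
  assumes "n > 0" and "x \<noteq> 0"
  shows "poly (flow_polynomial (complete_graph n)) x =
    (-1) ^ (n * (n - 1) div 2) / x ^ n *
    (\<Sum>L\<in>number_partitions n.
       of_nat (num_divisions L) * (1 - x) ^ num_inner_pairs L *
       (\<Prod>i<size L. (x - of_nat i)))"
proof -
  have "x ^ n * poly (flow_polynomial (complete_graph n)) x = poly (flow_numerator n) x"
    by (simp add: poly_monom flip: monom_mult_flow_polynomial)
  then have "poly (flow_polynomial (complete_graph n)) x = poly (flow_numerator n) x / x ^ n"
    using \<open>x \<noteq> 0\<close> by (simp add: nonzero_eq_divide_eq mult.commute)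
  then show ?thesis
    by (simp only: poly_flow_numerator choose_two times_divide_eq_left)
qed

end
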